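(* Let $F$ be a CNF formula over the finite set $X$ of variables, let $D=\{0,1,*\}$, let $s_F:X\times D\to\mathbb{R}_{\ge0}$ be a unitary weighting seed, and let $w_F(\sigma,x)=\omega_F(x,\sigma(x),A_F(\sigma,x))$ for every valid valuation $\sigma$ and $x\in X$, where $$\omega_F(x,a,\Delta)=\begin{cases}s_F(x,a)&\text{if }a=*\text{ and }a\in\Delta,\\ s_F(x,a)+\sum_{b\in D\setminus\Delta}s_F(x,b)&\text{if }a\ne *\text{ and }a\in\Delta,\\0&\text{if }a\notin\Delta.\end{cases}$$ If $F$ admits a boolean solution, then $\gamma(F)\ge1$, where $\gamma(F)=\sum_{\sigma\in\mathcal{S}(F)}\prod_{x\in X}w_F(\sigma,x)$.
   Context: Valuations are maps $X\to D=\{0,1,*\}$. Under a valuation, a literal is starred if its variable has value $*$; it is true if its variable has value $1$ and the literal is positive, or its variable has value $0$ and the literal is negative. A valuation is valid for $F$ iff each clause of $F$ contains at least one true literal or at least two starred literals. $\mathcal{S}(F)$ denotes the set of valid valuations of $F$. A boolean solution is a valid valuation with all values in $\{0,1\}$. For $\sigma\in\mathcal{S}(F)$ and $x\in X$, $A_F(\sigma,x)$ is the set of values $\tau(x)$ over all $\tau\in\mathcal{S}(F)$ agreeing with $\sigma$ on all variables other than $x$ (including $\tau=\sigma$). A weighting seed $s_F$ is unitary iff $s_F(x,0)+s_F(x,1)+s_F(x,* )=1$ for all $x\in X$. *)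

theory Defs
  imports Complex_Main "HOL-Library.FuncSet"
begin

datatype 'v literal = Pos (var: 'v) | Neg (var: 'v)

text \<open>Clauses are sets of literals, so that two starred literals of a clause are two distinct
  literals; a clause may be empty or contain a variable with both signs.\<close>

type_synonym 'v clause = "'v literal set"
type_synonym 'v cnf = "'v clause set"

definition cnf_over :: "'v set \<Rightarrow> 'v cnf \<Rightarrow> bool" where
  "cnf_over X F \<longleftrightarrow> finite F \<and> (\<forall>C\<in>F. finite C \<and> var ` C \<subseteq> X)"

datatype val = Zero | One | Star

instance val :: finite
proof
  have "(UNIV :: val set) = {Zero, One, Star}"
    using val.exhaust by auto
  then show "finite (UNIV :: val set)"
    by (metis finite.emptyI finite_insert)
qed

definition starred :: "('v \<Rightarrow> val) \<Rightarrow> 'v literal \<Rightarrow> bool" where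
  "starred \<sigma> l \<longleftrightarrow> \<sigma> (var l) = Star"

fun lit_true :: "('v \<Rightarrow> val) \<Rightarrow> 'v literal \<Rightarrow> bool" where
  "lit_true \<sigma> (Pos x) \<longleftrightarrow> \<sigma> x = One"
| "lit_true \<sigma> (Neg x) \<longleftrightarrow> \<sigma> x = Zero"

definition valid :: "'v cnf \<Rightarrow> ('v \<Rightarrow> val) \<Rightarrow> bool" where
  "valid F \<sigma> \<longleftrightarrow> (\<forall>C\<in>F. (\<exists>l\<in>C. lit_true \<sigma> l) \<or> card {l\<in>C. starred \<sigma> l} \<ge> 2)"

text \<open>Valuations on \<open>X\<close> are the extensional functions on \<open>X\<close>, so that each of them is
  counted once in sums over valid valuations.\<close>

definition valid_valuations :: "'v set \<Rightarrow> 'v cnf \<Rightarrow> ('v \<Rightarrow> val) set" where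
  "valid_valuations X F = {\<sigma> \<in> X \<rightarrow>\<^sub>E UNIV. valid F \<sigma>}"

definition boolean_solution :: "'v set \<Rightarrow> 'v cnf \<Rightarrow> ('v \<Rightarrow> val) \<Rightarrow> bool" where
  "boolean_solution X F \<sigma> \<longleftrightarrow> \<sigma> \<in> valid_valuations X F \<and> (\<forall>x\<in>X. \<sigma> x \<in> {Zero, One})"

definition allowed :: "'v set \<Rightarrow> 'v cnf \<Rightarrow> ('v \<Rightarrow> val) \<Rightarrow> 'v \<Rightarrow> val set" where
  "allowed X F \<sigma> x = {\<tau> x |\<tau>. \<tau> \<in> valid_valuations X F \<and> (\<forall>y\<in>X - {x}. \<tau> y = \<sigma> y)}"

definition weighting_seed :: "'v set \<Rightarrow> ('v \<Rightarrow> val \<Rightarrow> real) \<Rightarrow> bool" where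
  "weighting_seed X s \<longleftrightarrow> (\<forall>x\<in>X. \<forall>a. s x a \<ge> 0)"

definition unitary :: "'v set \<Rightarrow> ('v \<Rightarrow> val \<Rightarrow> real) \<Rightarrow> bool" where
  "unitary X s \<longleftrightarrow> (\<forall>x\<in>X. s x Zero + s x One + s x Star = 1)"

definition omega :: "('v \<Rightarrow> val \<Rightarrow> real) \<Rightarrow> 'v \<Rightarrow> val \<Rightarrow> val set \<Rightarrow> real" where
  "omega s x a \<Delta> =
    (if a \<notin> \<Delta> then 0
     else if a = Star then s x a
     else s x a + (\<Sum>b\<in>UNIV - \<Delta>. s x b))"

definition gamma :: "'v set \<Rightarrow> 'v cnf \<Rightarrow> (('v \<Rightarrow> val) \<Rightarrow> 'v \<Rightarrow> real) \<Rightarrow> real" where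
  "gamma X F w = (\<Sum>\<sigma>\<in>valid_valuations X F. \<Prod>x\<in>X. w \<sigma> x)"

end

theory Submission
  imports Defs
begin

text \<open>Draw \<open>a x\<close> independently for each \<open>x\<close> with law \<open>s x\<close>. The weight of a valid valuation
  \<open>\<sigma>\<close> is then the probability that \<open>\<sigma>\<close> is compatible with \<open>a\<close>, meaning that every \<open>x\<close>
  satisfies \<open>\<sigma> x = a x\<close>, unless \<open>a x\<close> is not allowed at \<open>x\<close> and \<open>\<sigma> x\<close> is not a star. Hence
  \<open>\<gamma>(F)\<close> is the expected number of compatible valid valuations. For every outcome \<open>a\<close> there is
  at least one: start from a boolean solution and, as long as some \<open>a x \<noteq> \<sigma> x\<close> is allowed at
  \<open>x\<close>, set \<open>\<sigma> x\<close> to \<open>a x\<close>. A variable that has been changed is never changed again, so this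
  stops, and only variables with \<open>a x = *\<close> are ever starred.\<close>

definition compatible_values :: "'v set \<Rightarrow> 'v cnf \<Rightarrow> ('v \<Rightarrow> val) \<Rightarrow> 'v \<Rightarrow> val set" where
  "compatible_values X F \<sigma> x = {b. b = \<sigma> x \<or> \<sigma> x \<noteq> Star \<and> b \<notin> allowed X F \<sigma> x}"

lemma self_in_allowed:
  "\<sigma> \<in> valid_valuations X F \<Longrightarrow> \<sigma> x \<in> allowed X F \<sigma> x"
  unfolding allowed_def by blast

lemma finite_valid_valuations:
  "finite X \<Longrightarrow> finite (valid_valuations X F)"
  unfolding valid_valuations_def
  by (intro finite_Collect_conjI disjI1) (simp add: finite_PiE)

text \<open>Since \<open>\<sigma>\<close> is valid, its own value is allowed. So the zero case of
  \<open>omega\<close> never occurs, and without a star the value is disjoint from the forbidden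
  ones, whose sum \<open>omega\<close> adds.\<close>

lemma omega_eq_sum_compatible:
  assumes "\<sigma> \<in> valid_valuations X F"
  shows "omega s x (\<sigma> x) (allowed X F \<sigma> x) = (\<Sum>b\<in>compatible_values X F \<sigma> x. s x b)"
proof (cases "\<sigma> x = Star")
  case True
  then have "compatible_values X F \<sigma> x = {Star}"
    by (auto simp: compatible_values_def)
  with True show ?thesis
    using self_in_allowed[OF assms, of x] by (simp add: omega_def)
next
  case False
  then have "compatible_values X F \<sigma> x = insert (\<sigma> x) (UNIV - allowed X F \<sigma> x)"
    by (auto simp: compatible_values_def)
  with False show ?thesis
    using self_in_allowed[OF assms, of x] by (simp add: omega_def)
qed

lemma ex_compatible_valuation:
  assumes "finite X" "boolean_solution X F \<sigma>\<^sub>0" "a \<in> X \<rightarrow>\<^sub>E UNIV"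
  shows "\<exists>\<sigma>\<in>valid_valuations X F. a \<in> Pi\<^sub>E X (compatible_values X F \<sigma>)"
proof -
  \<comment> \<open>This invariant excludes the one incompatibility that no update could repair: a
    star at \<open>x\<close> while \<open>a x\<close> is another value that is not allowed
    there.\<close>
  define P where "P \<sigma> \<longleftrightarrow> \<sigma> \<in> valid_valuations X F \<and> (\<forall>x\<in>X. \<sigma> x = Star \<longrightarrow> a x = Star)" for \<sigma>
  \<comment> \<open>Minimizing the number of disagreements with \<open>a\<close> replaces the
    iteration.\<close>
  define d where "d \<sigma> = card {x\<in>X. \<sigma> x \<noteq> a x}" for \<sigma>
  have "P \<sigma>\<^sub>0"
    using assms(2) by (auto simp: P_def boolean_solution_def)
  then obtain \<sigma> where \<sigma>: "P \<sigma>" and least: "\<And>\<tau>. P \<tau> \<Longrightarrow> d \<sigma> \<le> d \<tau>"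
    using ex_has_least_nat[of P \<sigma>\<^sub>0 d] by blast
  have "a x \<in> compatible_values X F \<sigma> x" if "x \<in> X" for x
  proof (rule ccontr)
    assume bad: "a x \<notin> compatible_values X F \<sigma> x"
    with \<sigma> that have "a x \<in> allowed X F \<sigma> x" and neq: "a x \<noteq> \<sigma> x"
      by (auto simp: compatible_values_def P_def)
    then obtain \<tau> where \<tau>: "\<tau> \<in> valid_valuations X F" "\<tau> x = a x" "\<forall>y\<in>X - {x}. \<tau> y = \<sigma> y"
      unfolding allowed_def by auto
    \<comment> \<open>On \<open>X\<close>, only the value at \<open>x\<close> has changed, and it is
      now \<open>a x\<close>, so any new star agrees with \<open>a\<close>.\<close>
    then have "P \<tau>"
      using \<sigma> unfolding P_def by (metis DiffI singletonD)
    moreover have "{y\<in>X. \<tau> y \<noteq> a y} \<subset> {y\<in>X. \<sigma> y \<noteq> a y}"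
      using \<tau> neq that by force
    then have "d \<tau> < d \<sigma>"
      unfolding d_def using assms(1) by (intro psubset_card_mono) auto
    ultimately show False
      using least[of \<tau>] by simp
  qed
  with \<sigma> assms(3) show ?thesis
    by (auto simp: P_def PiE_iff)
qed

theorem theorem18:
  fixes X :: "'v set"
    and F :: "'v cnf"
    and s :: "'v \<Rightarrow> val \<Rightarrow> real"
    and w :: "('v \<Rightarrow> val) \<Rightarrow> 'v \<Rightarrow> real"
  assumes "finite X"
    and "cnf_over X F"
    and "weighting_seed X s"
    and "unitary X s"
    and "\<And>\<sigma> x. \<sigma> \<in> valid_valuations X F \<Longrightarrow> x \<in> X \<Longrightarrow>
           w \<sigma> x = omega s x (\<sigma> x) (allowed X F \<sigma> x)"
    and "\<exists>\<sigma>. boolean_solution X F \<sigma>"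
  shows "gamma X F w \<ge> 1"
proof -
  let ?S = "valid_valuations X F"
  let ?C = "\<lambda>\<sigma>. Pi\<^sub>E X (compatible_values X F \<sigma>)"
  define p where "p a = (\<Prod>x\<in>X. s x (a x))" for a
  have p_nonneg: "p a \<ge> 0" for a
    using assms(3) by (auto simp: p_def weighting_seed_def intro: prod_nonneg)
  have fin: "finite (?C \<sigma>)" for \<sigma>
    using assms(1) by (intro finite_PiE) auto
  have UNIV_val: "(UNIV :: val set) = {Zero, One, Star}"
    using val.exhaust by auto
  \<comment> \<open>The total probability is 1; expanding the product makes it a sum over all
    outcomes.\<close>
  have "1 = (\<Prod>x\<in>X. \<Sum>b\<in>UNIV. s x b)"
    using assms(4) by (simp add: unitary_def UNIV_val add.assoc)
  also have "\<dots> = (\<Sum>a\<in>X \<rightarrow>\<^sub>E UNIV. p a)"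
    unfolding p_def using assms(1) by (intro prod_sum_PiE) auto
  \<comment> \<open>Count pairs of a valid valuation and a compatible outcome. Each outcome occurs
    in at least one pair, and further pairs contribute nonnegative terms.\<close>
  also have "\<dots> \<le> (\<Sum>z\<in>Sigma ?S ?C. p (snd z))"
  proof (rule sum_le_included[where i = snd])
    show "finite (X \<rightarrow>\<^sub>E (UNIV :: val set))"
      using assms(1) by (intro finite_PiE) auto
    show "finite (Sigma ?S ?C)"
      using finite_valid_valuations[OF assms(1)] fin by (rule finite_SigmaI)
    show "\<forall>z\<in>Sigma ?S ?C. 0 \<le> p (snd z)"
      using p_nonneg by blast
    show "\<forall>a\<in>X \<rightarrow>\<^sub>E UNIV. \<exists>z\<in>Sigma ?S ?C. snd z = a \<and> p a \<le> p (snd z)"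
    proof
      fix a :: "'v \<Rightarrow> val" assume "a \<in> X \<rightarrow>\<^sub>E UNIV"
      then obtain \<sigma> where "\<sigma> \<in> ?S" "a \<in> ?C \<sigma>"
        using assms(1,6) ex_compatible_valuation by blast
      then show "\<exists>z\<in>Sigma ?S ?C. snd z = a \<and> p a \<le> p (snd z)"
        by (intro bexI[of _ "(\<sigma>, a)"]) auto
    qed
  qed
  also have "\<dots> = (\<Sum>\<sigma>\<in>?S. \<Sum>a\<in>?C \<sigma>. p a)"
    using finite_valid_valuations[OF assms(1)] fin
    by (subst sum.Sigma) (auto simp: case_prod_beta)
  also have "\<dots> = (\<Sum>\<sigma>\<in>?S. \<Prod>x\<in>X. w \<sigma> x)"
  proof (rule sum.cong[OF refl])
    fix \<sigma> assume \<sigma>: "\<sigma> \<in> ?S"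
    \<comment> \<open>By independence, the probability that \<open>\<sigma>\<close> is compatible
      factors over the variables.\<close>
    have "(\<Sum>a\<in>?C \<sigma>. p a) = (\<Prod>x\<in>X. \<Sum>b\<in>compatible_values X F \<sigma> x. s x b)"
      unfolding p_def using assms(1) by (intro prod_sum_PiE[symmetric]) auto
    with \<sigma> show "(\<Sum>a\<in>?C \<sigma>. p a) = (\<Prod>x\<in>X. w \<sigma> x)"
      by (simp add: assms(5) omega_eq_sum_compatible)
  qed
  finally show ?thesis
    by (simp add: gamma_def)
qed

end
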